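(* For a prime power $p$ and $n=p^2+p+1$, the projective distribution on $n$ processes has a communication complexity of $O(p)=O(\sqrt n)$ per process for (dense) matrix-vector multiplication. That is, there is an absolute constant $C$ such that for every prime power $p$, every projective distribution on $n=p^2+p+1$ processes and every process $k$, the communication complexity of process $k$ is at most $Cp\le C\sqrt n$.
   Context: Block setting. A square matrix $A$ is viewed as an $n\times n$ array of blocks $A_{i,j}$, $i,j\in N=\{0,1,\dots,n-1\}$, and vectors $x$, $y$ are split conformally into blocks $X_j$, $Y_i$. There are $n$ processes, labelled by $N$. A data distribution assigns blocks of $A$ to processes. In computing $y=Ax$, process $k$ multiplies $A_{i,j}X_j$ for each block $A_{i,j}$ assigned to it, thus needing input block $X_j$ and producing a partial sum for $Y_i$. Row and column sub-blocks: the number $r$ of row sub-blocks of process $k$ is the number of row indices $i$ such that some $A_{i,j}$ is assigned to $k$; the number $c$ of column sub-blocks of $k$ is the number of column indices $j$ such that some $A_{i,j}$ is assigned to $k$. Communication complexity: the communication complexity of process $k$ for matrix-vector multiplication is $r+c$, measured in vector blocks ($c$ input blocks to be received and $r$ output partial-sum blocks to be sent). Projective distribution: let $p$ be a prime power and $n=p^2+p+1$. Label both the $n$ points and the $n$ lines of the projective plane $\mathbb{P}(2,\mathbb{GF}(p))$ by $N$, and let $c(k)\subset N$ denote the set of the $p+1$ points on line $k$. The distribution assigns $A_{i,i}$ to process $i$ for each $i$, and for every process $k$ and every pair of distinct points $i,j\in c(k)$ it assigns both $A_{i,j}$ and $A_{j,i}$ to process $k$. *)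

theory Defs
  imports Complex_Main "HOL-Algebra.Ring" "HOL-Algebra.Coset" "HOL-Number_Theory.Prime_Powers"
begin

section \<open>The projective plane over a field\<close>

type_synonym 'a vec3 = "'a \<times> 'a \<times> 'a"

definition vec3 :: "('a, 'm) ring_scheme \<Rightarrow> 'a vec3 set" where
  "vec3 F = carrier F \<times> carrier F \<times> carrier F"

definition zero3 :: "('a, 'm) ring_scheme \<Rightarrow> 'a vec3" where
  "zero3 F = (\<zero>\<^bsub>F\<^esub>, \<zero>\<^bsub>F\<^esub>, \<zero>\<^bsub>F\<^esub>)"

fun add3 :: "('a, 'm) ring_scheme \<Rightarrow> 'a vec3 \<Rightarrow> 'a vec3 \<Rightarrow> 'a vec3" where
  "add3 F (x, y, z) (x', y', z') = (x \<oplus>\<^bsub>F\<^esub> x', y \<oplus>\<^bsub>F\<^esub> y', z \<oplus>\<^bsub>F\<^esub> z')"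

fun smult3 :: "('a, 'm) ring_scheme \<Rightarrow> 'a \<Rightarrow> 'a vec3 \<Rightarrow> 'a vec3" where
  "smult3 F a (x, y, z) = (a \<otimes>\<^bsub>F\<^esub> x, a \<otimes>\<^bsub>F\<^esub> y, a \<otimes>\<^bsub>F\<^esub> z)"

definition lin_indep2 :: "('a, 'm) ring_scheme \<Rightarrow> 'a vec3 \<Rightarrow> 'a vec3 \<Rightarrow> bool" where
  "lin_indep2 F v w \<longleftrightarrow>
     (\<forall>a\<in>carrier F. \<forall>b\<in>carrier F.
        add3 F (smult3 F a v) (smult3 F b w) = zero3 F \<longrightarrow> a = \<zero>\<^bsub>F\<^esub> \<and> b = \<zero>\<^bsub>F\<^esub>)"

definition span1 :: "('a, 'm) ring_scheme \<Rightarrow> 'a vec3 \<Rightarrow> 'a vec3 set" where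
  "span1 F v = {smult3 F a v | a. a \<in> carrier F}"

definition span2 :: "('a, 'm) ring_scheme \<Rightarrow> 'a vec3 \<Rightarrow> 'a vec3 \<Rightarrow> 'a vec3 set" where
  "span2 F v w = {add3 F (smult3 F a v) (smult3 F b w) | a b. a \<in> carrier F \<and> b \<in> carrier F}"

text \<open>Points and lines are the one- and two-dimensional subspaces of the space of triples
  over \<open>F\<close>; a point lies on a line iff it is contained in it.\<close>

definition proj_points :: "('a, 'm) ring_scheme \<Rightarrow> 'a vec3 set set" where
  "proj_points F = {span1 F v | v. v \<in> vec3 F \<and> v \<noteq> zero3 F}"

definition proj_lines :: "('a, 'm) ring_scheme \<Rightarrow> 'a vec3 set set" where
  "proj_lines F = {span2 F v w | v w. v \<in> vec3 F \<and> w \<in> vec3 F \<and> lin_indep2 F v w}"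


section \<open>Block distributions and communication complexity\<close>

text \<open>\<open>D i j\<close> is the process to which the block in block row \<open>i\<close> and block column \<open>j\<close>
  is assigned; processes, block rows and block columns are numbered by \<open>{..<n}\<close>, and values
  of \<open>D\<close> outside this range are irrelevant. The matrix is dense, so every block
  takes part in the multiplication.\<close>

definition data_distribution :: "nat \<Rightarrow> (nat \<Rightarrow> nat \<Rightarrow> nat) \<Rightarrow> bool" where
  "data_distribution n D \<longleftrightarrow> (\<forall>i<n. \<forall>j<n. D i j < n)"

definition row_sub_blocks :: "nat \<Rightarrow> (nat \<Rightarrow> nat \<Rightarrow> nat) \<Rightarrow> nat \<Rightarrow> nat" where
  "row_sub_blocks n D k = card {i. i < n \<and> (\<exists>j<n. D i j = k)}"

definition column_sub_blocks :: "nat \<Rightarrow> (nat \<Rightarrow> nat \<Rightarrow> nat) \<Rightarrow> nat \<Rightarrow> nat" where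
  "column_sub_blocks n D k = card {j. j < n \<and> (\<exists>i<n. D i j = k)}"

definition communication_complexity :: "nat \<Rightarrow> (nat \<Rightarrow> nat \<Rightarrow> nat) \<Rightarrow> nat \<Rightarrow> nat" where
  "communication_complexity n D k = row_sub_blocks n D k + column_sub_blocks n D k"


section \<open>The projective distribution\<close>

definition points_on_line ::
    "nat \<Rightarrow> (nat \<Rightarrow> 'a vec3 set) \<Rightarrow> (nat \<Rightarrow> 'a vec3 set) \<Rightarrow> nat \<Rightarrow> nat set" where
  "points_on_line n P L k = {i. i < n \<and> P i \<subseteq> L k}"

text \<open>The field with \<open>p\<close> elements is unique up to isomorphism, and only the incidence relation
  enters the distribution. Taking the elements of the field to be natural numbers
  is therefore no restriction, and it allows one constant to be chosen for
  all fields at once, which is impossible if the field is a type.\<close>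

definition projective_distribution :: "nat \<Rightarrow> nat \<Rightarrow> (nat \<Rightarrow> nat \<Rightarrow> nat) \<Rightarrow> bool" where
  "projective_distribution p n D \<longleftrightarrow>
     data_distribution n D \<and>
     (\<exists>(F :: nat ring) P L.
        field F \<and> finite (carrier F) \<and> order F = p \<and>
        bij_betw P {..<n} (proj_points F) \<and>
        bij_betw L {..<n} (proj_lines F) \<and>
        (\<forall>i<n. D i i = i) \<and>
        (\<forall>k<n. \<forall>i\<in>points_on_line n P L k. \<forall>j\<in>points_on_line n P L k.
           i \<noteq> j \<longrightarrow> D i j = k \<and> D j i = k))"

end

theory Submission imports Defs begin

text \<open>If block \<open>(i, j)\<close> with \<open>i \<noteq> j\<close> belongs to process \<open>k\<close>, then \<open>k\<close> is the line joining
  the points \<open>i\<close> and \<open>j\<close>, so both indices lie in \<open>c(k)\<close>. Every row or column sub-block of \<open>k\<close>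
  therefore has its index in \<open>c(k) \<union> {k}\<close>, where the \<open>k\<close> is due to the diagonal block. Since
  a line has at most \<open>p + 1\<close> points, the complexity is at most \<open>2 (p + 2) \<le> 4 p\<close>.\<close>

context field
begin

lemma smult3_closed:
  assumes "a \<in> carrier R" "v \<in> vec3 R"
  shows "smult3 R a v \<in> vec3 R"
  using assms by (cases v) (auto simp: vec3_def)

lemma smult3_smult3:
  assumes "a \<in> carrier R" "b \<in> carrier R" "v \<in> vec3 R"
  shows "smult3 R a (smult3 R b v) = smult3 R (a \<otimes> b) v"
  using assms by (cases v) (auto simp: vec3_def m_assoc)

lemma smult3_one: "v \<in> vec3 R \<Longrightarrow> smult3 R \<one> v = v"
  by (cases v) (auto simp: vec3_def)

lemma smult3_zero: "v \<in> vec3 R \<Longrightarrow> smult3 R \<zero> v = zero3 R"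
  by (cases v) (auto simp: vec3_def zero3_def)

lemma smult3_add3:
  assumes "a \<in> carrier R" "v \<in> vec3 R" "w \<in> vec3 R"
  shows "smult3 R a (add3 R v w) = add3 R (smult3 R a v) (smult3 R a w)"
  using assms by (cases v; cases w) (auto simp: vec3_def r_distr)

lemma add3_closed:
  assumes "v \<in> vec3 R" "w \<in> vec3 R"
  shows "add3 R v w \<in> vec3 R"
  using assms by (cases v; cases w) (auto simp: vec3_def)

lemma add3_zero3:
  assumes "v \<in> vec3 R"
  shows "add3 R v (zero3 R) = v" "add3 R (zero3 R) v = v"
  using assms by (cases v; auto simp: vec3_def zero3_def)+

lemma smult3_eq_zero3_iff:
  assumes "a \<in> carrier R" "v \<in> vec3 R"
  shows "smult3 R a v = zero3 R \<longleftrightarrow> a = \<zero> \<or> v = zero3 R"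
  using assms by (cases v) (auto simp: vec3_def zero3_def integral_iff)

lemma smult3_uminus_eq_if_add3_eq_zero3:
  assumes "a \<in> carrier R" "b \<in> carrier R" "v \<in> vec3 R" "w \<in> vec3 R"
    and "add3 R (smult3 R a v) (smult3 R b w) = zero3 R"
  shows "smult3 R a v = smult3 R (\<ominus> b) w"
  using assms
  by (cases v; cases w) (auto simp: vec3_def zero3_def l_minus intro!: minus_equality[symmetric])

lemma Units_inv_field:
  assumes "a \<in> carrier R" "a \<noteq> \<zero>"
  shows "inv a \<in> carrier R" "inv a \<otimes> a = \<one>" "a \<otimes> inv a = \<one>"
  using assms by (auto simp: field_Units)

text \<open>Since \<open>c\<close> is invertible, coefficients convert in both directions between
  \<open>v\<close> and its multiple. Hence a point does not depend on the nonzero vector chosen to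
  represent it.\<close>

lemma span1_smult3:
  assumes "c \<in> carrier R" "c \<noteq> \<zero>" "v \<in> vec3 R"
  shows "span1 R (smult3 R c v) = span1 R v"
proof -
  note c = Units_inv_field[OF assms(1,2)]
  have "\<exists>b\<in>carrier R. smult3 R a v = smult3 R b (smult3 R c v)" if "a \<in> carrier R" for a
    using that assms c by (intro bexI[of _ "a \<otimes> inv c"]) (auto simp: smult3_smult3 m_assoc)
  moreover have "\<exists>b\<in>carrier R. smult3 R a (smult3 R c v) = smult3 R b v" if "a \<in> carrier R" for a
    using that assms by (intro bexI[of _ "a \<otimes> c"]) (auto simp: smult3_smult3)
  ultimately show ?thesis
    unfolding span1_def by blast
qed

text \<open>A nontrivial relation would equate a nonzero multiple of \<open>v\<close> with a nonzero
  multiple of \<open>w\<close>, and rescaling does not change a span, so the two points would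
  coincide.\<close>

lemma lin_indep2_if_span1_neq:
  assumes v: "v \<in> vec3 R" "v \<noteq> zero3 R" and w: "w \<in> vec3 R" "w \<noteq> zero3 R"
    and neq: "span1 R v \<noteq> span1 R w"
  shows "lin_indep2 R v w"
  unfolding lin_indep2_def
proof (intro ballI impI)
  fix a b
  assume a: "a \<in> carrier R" and b: "b \<in> carrier R"
    and "add3 R (smult3 R a v) (smult3 R b w) = zero3 R"
  then have eq: "smult3 R a v = smult3 R (\<ominus> b) w"
    using v w by (intro smult3_uminus_eq_if_add3_eq_zero3)
  \<comment> \<open>Both vectors are nonzero and a field has no zero divisors, so either side of
    \<open>eq\<close> vanishes only with its scalar. If \<open>a\<close> is nonzero, both scalars
    can therefore be divided out.\<close>
  then have iff: "a = \<zero> \<longleftrightarrow> \<ominus> b = \<zero>"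
    using smult3_eq_zero3_iff[OF a v(1)] smult3_eq_zero3_iff[of "\<ominus> b" w] b v w by auto
  have "a = \<zero>"
  proof (rule ccontr)
    assume "a \<noteq> \<zero>"
    then have "span1 R v = span1 R w"
      using span1_smult3[of a v] span1_smult3[of "\<ominus> b" w] a b v w eq iff by auto
    with neq show False ..
  qed
  with iff b show "a = \<zero> \<and> b = \<zero>"
    by (metis minus_minus minus_zero)
qed

lemma span1_subset_span2:
  assumes "v \<in> vec3 R" "w \<in> vec3 R"
  shows "span1 R v \<subseteq> span2 R v w" "span1 R w \<subseteq> span2 R v w"
proof -
  have "smult3 R a v = add3 R (smult3 R a v) (smult3 R \<zero> w)"
    and "smult3 R a w = add3 R (smult3 R \<zero> v) (smult3 R a w)" if "a \<in> carrier R" for a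
    using that assms by (simp_all add: smult3_zero add3_zero3 smult3_closed)
  then show "span1 R v \<subseteq> span2 R v w" "span1 R w \<subseteq> span2 R v w"
    unfolding span1_def span2_def using zero_closed by blast+
qed

text \<open>Vectors representing distinct points are independent, so their span is a line. In the
  distribution this line is the process that owns the off-diagonal block of the two points.\<close>

lemma proj_line_through_points:
  assumes "P \<in> proj_points R" "Q \<in> proj_points R" "P \<noteq> Q"
  shows "\<exists>l\<in>proj_lines R. P \<subseteq> l \<and> Q \<subseteq> l"
proof -
  obtain v w where v: "v \<in> vec3 R" "v \<noteq> zero3 R" "P = span1 R v"
    and w: "w \<in> vec3 R" "w \<noteq> zero3 R" "Q = span1 R w"
    using assms unfolding proj_points_def by blast
  then have "span2 R v w \<in> proj_lines R"
    using assms(3) lin_indep2_if_span1_neq unfolding proj_lines_def by blast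
  moreover have "P \<subseteq> span2 R v w" "Q \<subseteq> span2 R v w"
    using span1_subset_span2 v(1,3) w(1,3) by simp_all
  ultimately show ?thesis by blast
qed

text \<open>Normalising the coordinates \<open>(a, b)\<close> of a representative parametrises the
  line: \<open>b = \<zero>\<close> gives the point of \<open>v\<close>, and otherwise scaling to
  \<open>b = \<one>\<close> leaves one free coefficient from the field.\<close>

lemma proj_points_on_line_subset:
  assumes v: "v \<in> vec3 R" and w: "w \<in> vec3 R"
  shows "{P \<in> proj_points R. P \<subseteq> span2 R v w}
    \<subseteq> insert (span1 R v) ((\<lambda>a. span1 R (add3 R (smult3 R a v) w)) ` carrier R)"
proof
  fix P
  assume "P \<in> {P \<in> proj_points R. P \<subseteq> span2 R v w}"
  then obtain u where u: "u \<in> vec3 R" "u \<noteq> zero3 R" "P = span1 R u" and sub: "P \<subseteq> span2 R v w"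
    unfolding proj_points_def by blast
  have "u \<in> P"
    using u(1,3) smult3_one[OF u(1)] one_closed unfolding span1_def by force
  with sub obtain a b where ab: "a \<in> carrier R" "b \<in> carrier R"
    and ueq: "u = add3 R (smult3 R a v) (smult3 R b w)"
    unfolding span2_def by blast
  show "P \<in> insert (span1 R v) ((\<lambda>a. span1 R (add3 R (smult3 R a v) w)) ` carrier R)"
  proof (cases "b = \<zero>")
    case True
    then have "u = smult3 R a v"
      using ueq ab v w by (simp add: smult3_zero add3_zero3 smult3_closed)
    moreover from this have "a \<noteq> \<zero>"
      using u(2) smult3_zero[OF v] by auto
    ultimately show ?thesis
      using u(3) span1_smult3 ab v by auto
  next
    case False
    note b = Units_inv_field[OF ab(2) False]
    \<comment> \<open>This is \<open>u\<close> divided by \<open>b\<close>, which represents the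
      same point and has coefficient \<open>\<one>\<close> at \<open>w\<close>.\<close>
    let ?z = "add3 R (smult3 R (inv b \<otimes> a) v) w"
    have "b \<otimes> (inv b \<otimes> a) = a"
      using ab b by (simp add: m_assoc[symmetric])
    then have "u = smult3 R b ?z"
      using ueq ab b v w by (simp add: smult3_add3 smult3_closed smult3_smult3)
    then have "P = span1 R ?z"
      using u(3) span1_smult3[OF ab(2) False] ab b v w by (simp add: add3_closed smult3_closed)
    with ab b show ?thesis by auto
  qed
qed

text \<open>The parametrisation offers one exceptional point and at most one further point per field
  element.\<close>

lemma card_proj_points_on_line_le:
  assumes fin: "finite (carrier R)" and l: "l \<in> proj_lines R"
  shows "finite {P \<in> proj_points R. P \<subseteq> l}" "card {P \<in> proj_points R. P \<subseteq> l} \<le> order R + 1"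
proof -
  obtain v w where vw: "v \<in> vec3 R" "w \<in> vec3 R" and l: "l = span2 R v w"
    using l unfolding proj_lines_def by blast
  let ?f = "\<lambda>a. span1 R (add3 R (smult3 R a v) w)"
  have sub: "{P \<in> proj_points R. P \<subseteq> l} \<subseteq> insert (span1 R v) (?f ` carrier R)"
    unfolding l using vw by (rule proj_points_on_line_subset)
  have fin': "finite (insert (span1 R v) (?f ` carrier R))"
    using fin by simp
  show "finite {P \<in> proj_points R. P \<subseteq> l}"
    using sub fin' by (rule finite_subset)
  have "card (insert (span1 R v) (?f ` carrier R)) \<le> Suc (card (?f ` carrier R))"
    by (rule card_insert_le_m1) auto
  also have "\<dots> \<le> order R + 1"
    using card_image_le[OF fin] by (simp add: order_def)
  finally show "card {P \<in> proj_points R. P \<subseteq> l} \<le> order R + 1"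
    using card_mono[OF fin' sub] by linarith
qed

end

lemma communication_complexity_projective_le:
  assumes "projective_distribution p n D" "k < n"
  shows "communication_complexity n D k \<le> 2 * (p + 2)"
proof -
  from assms(1) obtain F :: "nat ring" and P L where
    F: "field F" "finite (carrier F)" "order F = p"
    and P: "bij_betw P {..<n} (proj_points F)"
    and L: "bij_betw L {..<n} (proj_lines F)"
    and diag: "\<And>i. i < n \<Longrightarrow> D i i = i"
    and off: "\<And>k i j. k < n \<Longrightarrow> i \<in> points_on_line n P L k \<Longrightarrow> j \<in> points_on_line n P L k
      \<Longrightarrow> i \<noteq> j \<Longrightarrow> D i j = k"
    unfolding projective_distribution_def by metis
  let ?c = "points_on_line n P L k"
  \<comment> \<open>Confining both indices at once lets the same fact bound the row and the column
    sub-blocks.\<close>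
  have mem: "i \<in> insert k ?c \<and> j \<in> insert k ?c" if "i < n" "j < n" "D i j = k" for i j
  proof (cases "i = j")
    case True
    then show ?thesis using diag that by auto
  next
    case False
    then have "P i \<noteq> P j" "P i \<in> proj_points F" "P j \<in> proj_points F"
      using P that unfolding bij_betw_def inj_on_def by auto
    then obtain l where l: "l \<in> proj_lines F" "P i \<subseteq> l" "P j \<subseteq> l"
      using field.proj_line_through_points[OF F(1)] by blast
    \<comment> \<open>The labelling \<open>L\<close> is onto the lines, so the joining line is the
      line of some process \<open>m\<close>.\<close>
    from l(1) obtain m where "m < n" "l = L m"
      unfolding bij_betw_imp_surj_on[OF L, symmetric] by blast
    with l(2,3) have m: "i \<in> points_on_line n P L m" "j \<in> points_on_line n P L m"
      using that by (auto simp: points_on_line_def)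
    \<comment> \<open>The distribution gives the block to \<open>m\<close>, while by assumption it
      belongs to \<open>k\<close>.\<close>
    with off[OF \<open>m < n\<close>] False that have "m = k" by auto
    with m show ?thesis by auto
  qed
  have Lk: "L k \<in> proj_lines F"
    using L assms(2) unfolding bij_betw_def by auto
  \<comment> \<open>The injective labelling \<open>P\<close> transfers the bound on geometric points
    to their indices.\<close>
  have "P ` ?c \<subseteq> {Q \<in> proj_points F. Q \<subseteq> L k}"
    using P unfolding points_on_line_def bij_betw_def by auto
  moreover have "inj_on P ?c"
    using P unfolding points_on_line_def bij_betw_def inj_on_def by auto
  ultimately have "card ?c \<le> card {Q \<in> proj_points F. Q \<subseteq> L k}"
    using field.card_proj_points_on_line_le(1)[OF F(1,2) Lk] by (intro card_inj_on_le)
  also have "\<dots> \<le> p + 1"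
    using field.card_proj_points_on_line_le(2)[OF F(1,2) Lk] F(3) by simp
  finally have "card ?c \<le> p + 1" .
  moreover have fin: "finite (insert k ?c)"
    by (simp add: points_on_line_def)
  \<comment> \<open>Point \<open>k\<close> may or may not lie on line \<open>k\<close>; the bound
    covers both cases.\<close>
  ultimately have card: "card (insert k ?c) \<le> p + 2"
    using card_insert_if[of ?c k] by (auto split: if_splits)
  have "row_sub_blocks n D k \<le> p + 2" "column_sub_blocks n D k \<le> p + 2"
    unfolding row_sub_blocks_def column_sub_blocks_def
    by (rule order_trans[OF card_mono[OF fin] card]; use mem in blast)+
  then show ?thesis
    by (simp add: communication_complexity_def)
qed

theorem lemma4:
  shows "\<exists>C::real. \<forall>(p::nat) (n::nat) (D :: nat \<Rightarrow> nat \<Rightarrow> nat) (k::nat).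
    primepow p \<and> n = p^2 + p + 1 \<and> projective_distribution p n D \<and> k < n \<longrightarrow>
      real (communication_complexity n D k) \<le> C * real p \<and> C * real p \<le> C * sqrt (real n)"
proof (intro exI[of _ 4] allI impI)
  fix p n k :: nat and D :: "nat \<Rightarrow> nat \<Rightarrow> nat"
  assume A: "primepow p \<and> n = p^2 + p + 1 \<and> projective_distribution p n D \<and> k < n"
  \<comment> \<open>From \<open>p \<ge> 2\<close> follows \<open>p + 2 \<le> 2 * p\<close>, which
    absorbs the additive constant into the factor 4.\<close>
  then have "p \<ge> 2"
    using primepow_gt_Suc_0[of p] by simp
  moreover have "communication_complexity n D k \<le> 2 * (p + 2)"
    using A communication_complexity_projective_le by blast
  ultimately have "communication_complexity n D k \<le> 4 * p"
    by simp
  then have "real (communication_complexity n D k) \<le> 4 * real p"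
    using of_nat_mono by fastforce
  \<comment> \<open>Here \<open>n = p^2 + p + 1\<close> exceeds \<open>p^2\<close>.\<close>
  moreover have "real p \<le> sqrt (real n)"
    using A by (intro real_le_rsqrt) simp
  ultimately show "real (communication_complexity n D k) \<le> 4 * real p
    \<and> 4 * real p \<le> 4 * sqrt (real n)"
    by simp
qed

end
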